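(* Let $\lambda\in\mathbb{R}$, let $r\ge 0$ be an integer, and let $x$ be an indeterminate (or any real number). For every integer $n\ge 0$, $$x^{n}n!=\sum_{k=0}^{n}(-1)^{n-k}{n+r \brack k+r}_{r,\lambda}F_{k,\lambda}(x|r).$$
   Context: For $\lambda\in\mathbb{R}$ put $(y)_{0,\lambda}=1$, $(y)_{n,\lambda}=y(y-\lambda)\cdots(y-(n-1)\lambda)$ and $\langle y\rangle_{0,\lambda}=1$, $\langle y\rangle_{n,\lambda}=y(y+\lambda)\cdots(y+(n-1)\lambda)$ for $n\ge 1$. Also $\langle y\rangle_0=1$ and $\langle y\rangle_n=y(y+1)\cdots(y+n-1)$ for $n\ge1$. For an integer $r\ge 0$, the unsigned degenerate $r$-Stirling numbers of the first kind ${n+r \brack k+r}_{r,\lambda}$ ($0\le k\le n$) are defined by the polynomial identity in $y$: $\langle y+r\rangle_{n}=\sum_{k=0}^{n}{n+r \brack k+r}_{r,\lambda}\langle y\rangle_{k,\lambda}$ for $n\ge 0$. The degenerate exponential functions are the formal power series $e_{\lambda}^{y}(t)=\sum_{n=0}^{\infty}(y)_{n,\lambda}\frac{t^{n}}{n!}$, with $e_\lambda(t)=e_\lambda^1(t)$. The degenerate two variable Fubini polynomials $F_{n,\lambda}(x|y)$ are defined by the formal power series identity $$\frac{1}{1-x(e_{\lambda}(t)-1)}e_{\lambda}^{y}(t)=\sum_{n=0}^{\infty}F_{n,\lambda}(x|y)\frac{t^{n}}{n!}.$$ *)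

theory Defs
  imports "HOL-Computational_Algebra.Computational_Algebra"
begin

definition degen_falling :: "'a::comm_ring_1 \<Rightarrow> 'a \<Rightarrow> nat \<Rightarrow> 'a" where
  "degen_falling lam y n = (\<Prod>i<n. y - of_nat i * lam)"

definition degen_rising :: "'a::comm_ring_1 \<Rightarrow> 'a \<Rightarrow> nat \<Rightarrow> 'a" where
  "degen_rising lam y n = (\<Prod>i<n. y + of_nat i * lam)"

(* The identity <y + r>_n = sum_k c k * <y>_{k,lam} in the polynomial ring over the reals,
   with y the indeterminate [:0, 1:] and real numbers embedded as constant polynomials.
   The first conjunct makes c unique as a total function on nat. *)
definition is_rstirling1_row :: "real \<Rightarrow> nat \<Rightarrow> nat \<Rightarrow> (nat \<Rightarrow> real) \<Rightarrow> bool" where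
  "is_rstirling1_row lam r n c \<longleftrightarrow>
     (\<forall>k>n. c k = 0) \<and>
     pochhammer ([:0, 1:] + of_nat r) n = (\<Sum>k\<le>n. smult (c k) (degen_rising [:lam:] [:0, 1:] k))"

(* The arguments n and k are unshifted: the value is the number with upper index n + r and
   lower index k + r. *)
definition degen_rstirling1 :: "real \<Rightarrow> nat \<Rightarrow> nat \<Rightarrow> nat \<Rightarrow> real" where
  "degen_rstirling1 lam r n = (THE c. is_rstirling1_row lam r n c)"

lemma degree_degen_rising:
  "degree (degen_rising [:lam:] [:0, 1:] k :: real poly) = k \<and>
   coeff (degen_rising [:lam:] [:0, 1:] k :: real poly) k = 1"
proof -
  have eq: "[:0, 1:] + of_nat i * [:lam:] = [:of_nat i * lam, 1:]" for i
    by (simp add: of_nat_poly)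
  have d: "degree (degen_rising [:lam:] [:0, 1:] k :: real poly) = k"
    unfolding degen_rising_def eq by (subst degree_prod_eq_sum_degree) auto
  have "lead_coeff (degen_rising [:lam:] [:0, 1:] k :: real poly) = 1"
    unfolding degen_rising_def eq lead_coeff_prod by simp
  with d show ?thesis by simp
qed

lemma ex1_unique: "\<exists>!c. P c \<Longrightarrow> P d \<Longrightarrow> P c \<Longrightarrow> d = c"
  by blast

lemma ex1_expansion:
  fixes b :: "nat \<Rightarrow> real poly"
  assumes b: "\<And>k. degree (b k) = k \<and> coeff (b k) k = 1" and p: "degree p \<le> n"
  shows "\<exists>!c. (\<forall>k>n. c k = 0) \<and> p = (\<Sum>k\<le>n. smult (c k) (b k))"
  using p
proof (induction n arbitrary: p)
  case 0
  have b0: "b 0 = 1"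
  proof (rule poly_eqI)
    fix i show "coeff (b 0) i = coeff 1 i"
      using b[of 0] by (cases i) (simp_all add: coeff_eq_0)
  qed
  obtain a where p: "p = [:a:]" using 0 by (metis degree_eq_zeroE le_zero_eq)
  show ?case
  proof (rule ex1I[of _ "\<lambda>k. if k = 0 then a else 0"])
    fix c assume c: "(\<forall>k>0. c k = 0) \<and> p = (\<Sum>k\<le>0. smult (c k) (b k))"
    show "c = (\<lambda>k. if k = 0 then a else 0)"
      using c by (auto simp: p b0 fun_eq_iff)
  qed (simp add: p b0)
next
  case (Suc n)
  let ?a = "coeff p (Suc n)"
  let ?q = "p - smult ?a (b (Suc n))"
  have "coeff ?q i = 0" if "i > n" for i
  proof (cases "i = Suc n")
    case True
    then show ?thesis using b[of "Suc n"] by simp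
  next
    case False
    with that have "i > Suc n" by simp
    then show ?thesis using b[of "Suc n"] Suc.prems by (simp add: coeff_eq_0)
  qed
  then have "degree ?q \<le> n" by (intro degree_le) blast
  note ex1 = Suc.IH[OF this]
  obtain c where cc: "(\<forall>k>n. c k = 0) \<and> ?q = (\<Sum>k\<le>n. smult (c k) (b k))"
    using ex1_implies_ex[OF ex1] by (rule exE)
  note c = conjunct1[OF cc] conjunct2[OF cc]
  have u: "d = c" if "(\<forall>k>n. d k = 0) \<and> ?q = (\<Sum>k\<le>n. smult (d k) (b k))" for d
    by (rule ex1_unique[of "\<lambda>c. (\<forall>k>n. c k = 0) \<and> ?q = (\<Sum>k\<le>n. smult (c k) (b k))",
          OF ex1 that cc])
  have low: "coeff (\<Sum>k\<le>n. smult (d k) (b k)) (Suc n) = 0" for d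
    unfolding coeff_sum using b by (intro sum.neutral) (auto simp: coeff_eq_0)
  show ?case
  proof (rule ex1I[of _ "c(Suc n := ?a)"])
    have "(\<Sum>k\<le>n. smult ((c(Suc n := ?a)) k) (b k)) = ?q"
      unfolding c(2) by (rule sum.cong) auto
    then show "(\<forall>k>Suc n. (c(Suc n := ?a)) k = 0) \<and>
        p = (\<Sum>k\<le>Suc n. smult ((c(Suc n := ?a)) k) (b k))"
      using c(1) by simp
  next
    fix d assume d: "(\<forall>k>Suc n. d k = 0) \<and> p = (\<Sum>k\<le>Suc n. smult (d k) (b k))"
    then have pd: "p = (\<Sum>k\<le>n. smult (d k) (b k)) + smult (d (Suc n)) (b (Suc n))"
      by simp
    have ds: "d (Suc n) = ?a"
      by (subst pd) (use low[of d] b[of "Suc n"] in simp)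
    have "(\<Sum>k\<le>n. smult ((d(Suc n := 0)) k) (b k)) = (\<Sum>k\<le>n. smult (d k) (b k))"
      by (rule sum.cong) auto
    also have "\<dots> = ?q"
      unfolding ds[symmetric] using pd by (metis add_diff_cancel_right')
    finally have "?q = (\<Sum>k\<le>n. smult ((d(Suc n := 0)) k) (b k))" by (rule sym)
    moreover have "\<forall>k>n. (d(Suc n := 0)) k = 0" using d by auto
    ultimately have "d(Suc n := 0) = c" by (intro u conjI)
    then show "d = c(Suc n := ?a)" using ds by (metis fun_upd_triv fun_upd_upd)
  qed
qed

lemma ex1_rstirling1_row: "\<exists>!c. is_rstirling1_row lam r n c"
proof -
  have eq: "[:0, 1:] + of_nat r + of_nat i = [:of_nat (r + i), 1::real:]" for i
    by (simp add: of_nat_poly)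
  have "degree (pochhammer ([:0, 1::real:] + of_nat r) n) \<le> n"
    unfolding pochhammer_prod eq by (subst degree_prod_eq_sum_degree) auto
  then show ?thesis
    unfolding is_rstirling1_row_def
    by (intro ex1_expansion degree_degen_rising)
qed

lemma is_rstirling1_row_degen_rstirling1: "is_rstirling1_row lam r n (degen_rstirling1 lam r n)"
  unfolding degen_rstirling1_def by (rule theI'[OF ex1_rstirling1_row])

definition degen_exp :: "real \<Rightarrow> real \<Rightarrow> real fps" where
  "degen_exp lam y = Abs_fps (\<lambda>n. degen_falling lam y n / fact n)"

definition fps_const_coeffs :: "real fps \<Rightarrow> real poly fps" where
  "fps_const_coeffs f = Abs_fps (\<lambda>n. [:fps_nth f n:])"

definition fubini_denom :: "real \<Rightarrow> real poly fps" where
  "fubini_denom lam = 1 - fps_const [:0, 1:] * (fps_const_coeffs (degen_exp lam 1) - 1)"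

(* Formal power series in t over the polynomials in x. The denominator has constant term 1 and
   the coefficients are not a field, so its reciprocal is fps_right_inverse with the inverse
   1 of the constant term. *)
definition fubini_gf :: "real \<Rightarrow> real \<Rightarrow> real poly fps" where
  "fubini_gf lam y =
     fps_right_inverse (fubini_denom lam) 1 * fps_const_coeffs (degen_exp lam y)"

definition degen_fubini :: "real \<Rightarrow> nat \<Rightarrow> real \<Rightarrow> real poly" where
  "degen_fubini lam n y = smult (fact n) (fps_nth (fubini_gf lam y) n)"

lemma fps_nth_degen_exp_0 [simp]: "fps_nth (degen_exp lam y) 0 = 1"
  by (simp add: degen_exp_def degen_falling_def)

lemma fubini_denom_mult_inverse: "fubini_denom lam * fps_right_inverse (fubini_denom lam) 1 = 1"
  by (rule fps_right_inverse) (simp add: fubini_denom_def fps_const_coeffs_def one_pCons)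

lemma fubini_gf_eq: "fubini_denom lam * fubini_gf lam y = fps_const_coeffs (degen_exp lam y)"
  by (simp add: fubini_gf_def fubini_denom_mult_inverse flip: mult.assoc)

lemma poly_degen_fubini:
  "1 / (1 - fps_const x * (degen_exp lam 1 - 1)) * degen_exp lam y =
     Abs_fps (\<lambda>n. poly (degen_fubini lam n y) x / fact n)"
proof -
  let ?ev = "\<lambda>f :: real poly fps. Abs_fps (\<lambda>n. poly (fps_nth f n) x)"
  let ?D = "1 - fps_const x * (degen_exp lam 1 - 1)"
  have m: "?ev (f * g) = ?ev f * ?ev g" for f g
    by (rule fps_ext) (simp add: fps_mult_nth poly_sum)
  have D: "?ev (fubini_denom lam) = ?D"
    by (rule fps_ext) (simp add: fubini_denom_def fps_const_coeffs_def)
  have E: "?ev (fps_const_coeffs (degen_exp lam y)) = degen_exp lam y"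
    by (rule fps_ext) (simp add: fps_const_coeffs_def)
  have G: "?ev (fubini_gf lam y) = Abs_fps (\<lambda>n. poly (degen_fubini lam n y) x / fact n)"
    by (rule fps_ext) (simp add: degen_fubini_def)
  have *: "?D * ?ev (fubini_gf lam y) = degen_exp lam y"
    using m[of "fubini_denom lam" "fubini_gf lam y"] by (simp only: fubini_gf_eq D E)
  have nz: "fps_nth ?D 0 \<noteq> 0" by simp
  have inv: "1 / ?D = inverse ?D"
    using fps_divide_unit[OF nz, of 1] by simp
  have "1 / ?D * degen_exp lam y = (inverse ?D * ?D) * ?ev (fubini_gf lam y)"
    unfolding inv mult.assoc * ..
  also have "\<dots> = ?ev (fubini_gf lam y)"
    using inverse_mult_eq_1[OF nz] by simp
  finally show ?thesis unfolding G .
qed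

end

theory Submission
  imports Defs
begin

text \<open>
  Write \<open>E = e\<^sub>\<lambda>(t)\<close>. Expanding the geometric series, the coefficient of \<open>x\<^sup>j\<close> in the generating
  function of the Fubini polynomials with parameter \<open>y\<close> is \<open>(E - 1)\<^sup>j E\<^sup>y\<close>. The right-hand
  side of the claim arises by applying to this generating function, at \<open>y = r\<close>, the linear functional that sends
  \<open>t\<^sup>k / k!\<close> to the \<open>k\<close>-th signed Stirling number of row \<open>n\<close>.

  Replacing the indeterminate by its negative in the defining identity of the Stirling numbers shows
  that this functional sends \<open>E\<^sup>y\<close> to \<open>(y - r) (y - r - 1) \<dots> (y - r - n + 1)\<close>, that is, to \<open>n!\<close>
  times the binomial coefficient of \<open>y - r\<close> over \<open>n\<close>. Because \<open>E E\<^sup>y = E\<^sup>(\<^sup>y\<^sup>+\<^sup>1\<^sup>)\<close>, multiplication by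
  \<open>E - 1\<close> becomes the forward difference in \<open>y\<close>, which by Pascal's rule lowers the lower index of
  the binomial coefficient by one and ends at 0 after more than \<open>n\<close> steps. Hence, for \<open>j \<le> n\<close>,
  the functional sends \<open>(E - 1)\<^sup>j E\<^sup>y\<close> to \<open>n!\<close> times the binomial coefficient of \<open>y - r\<close> over
  \<open>n - j\<close>. At \<open>y = r\<close> this is the coefficient of \<open>x\<^sup>j\<close> on the right-hand side of the claim, and
  it equals \<open>n!\<close> for \<open>j = n\<close> and 0 otherwise.
\<close>

lemma degen_falling_Suc:
  "degen_falling lam y (Suc n) = (y - of_nat n * lam) * degen_falling lam y n"
  by (simp add: degen_falling_def mult.commute)

text \<open>
  Together with the constant term 1, the differential equation \<open>(1 + \<lambda>t) f' = y f\<close> characterises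
  \<open>e\<^sub>\<lambda>\<^sup>y(t)\<close>. It treats the binomial series \<open>(1 + \<lambda>t)\<^sup>(\<^sup>y\<^sup>/\<^sup>\<lambda>\<^sup>)\<close> for \<open>\<lambda> \<noteq> 0\<close> and the exponential series
  for \<open>\<lambda> = 0\<close> alike.
\<close>

lemma degen_exp_ode_iff:
  fixes f :: "real fps"
  shows "(1 + fps_const lam * fps_X) * fps_deriv f = fps_const y * f \<longleftrightarrow>
     (\<forall>n. of_nat (Suc n) * f $ Suc n = (y - of_nat n * lam) * f $ n)"
proof -
  have "((1 + fps_const lam * fps_X) * fps_deriv f) $ n =
      of_nat (Suc n) * f $ Suc n + of_nat n * lam * f $ n" for n
    by (cases n) (simp_all add: algebra_simps)
  then show ?thesis
    by (simp add: fps_eq_iff algebra_simps eq_diff_eq)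
qed

lemma degen_exp_ode:
  "(1 + fps_const lam * fps_X) * fps_deriv (degen_exp lam y) = fps_const y * degen_exp lam y"
  by (simp add: degen_exp_ode_iff degen_exp_def degen_falling_Suc divide_simps)

lemma degen_exp_ode_unique:
  assumes ode: "(1 + fps_const lam * fps_X) * fps_deriv f = fps_const y * f"
    and init: "f $ 0 = 1"
  shows "f = degen_exp lam y"
proof (rule fps_ext)
  fix n
  show "f $ n = degen_exp lam y $ n"
  proof (induction n)
    case 0
    show ?case by (simp add: init)
  next
    case (Suc n)
    have "of_nat (Suc n) * f $ Suc n = of_nat (Suc n) * degen_exp lam y $ Suc n"
      using ode degen_exp_ode[of lam y] Suc.IH unfolding degen_exp_ode_iff by simp
    then show ?case by (simp del: of_nat_Suc)
  qed
qed

text \<open>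
  Both sides solve the same differential equation, by the product rule. Comparing coefficients, this
  is the degenerate Vandermonde convolution.
\<close>

lemma degen_exp_add: "degen_exp lam (a + b) = degen_exp lam a * degen_exp lam b"
proof (rule degen_exp_ode_unique[symmetric])
  let ?w = "1 + fps_const lam * fps_X"
  let ?A = "degen_exp lam a" and ?B = "degen_exp lam b"
  have "?w * fps_deriv (?A * ?B) = (?w * fps_deriv ?A) * ?B + ?A * (?w * fps_deriv ?B)"
    by (simp add: algebra_simps)
  also have "\<dots> = fps_const (a + b) * (?A * ?B)"
    unfolding degen_exp_ode by (simp add: algebra_simps flip: fps_const_add)
  finally show "?w * fps_deriv (?A * ?B) = fps_const (a + b) * (?A * ?B)" .
qed simp

text \<open>
  Comparing powers of \<open>x\<close> in \<open>(1 - x (E - 1)) G = E\<^sup>y\<close> gives a recursion for the coefficients of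
  \<open>G\<close> that is solved by the terms of the geometric series.
\<close>

lemma coeff_fubini_gf:
  "Abs_fps (\<lambda>n. coeff (fubini_gf lam y $ n) j) = (degen_exp lam 1 - 1) ^ j * degen_exp lam y"
proof -
  define cf :: "nat \<Rightarrow> real poly fps \<Rightarrow> real fps"
    where "cf = (\<lambda>j g. Abs_fps (\<lambda>n. coeff (g $ n) j))"
  have cf_const: "cf 0 (fps_const_coeffs f) = f" "cf (Suc j) (fps_const_coeffs f) = 0" for f j
    by (simp_all add: cf_def fps_const_coeffs_def fps_eq_iff)
  have cf_mult: "cf j (fps_const_coeffs f * g) = f * cf j g" for f g j
    by (simp add: cf_def fps_const_coeffs_def fps_eq_iff fps_mult_nth coeff_sum)
  have cf_add: "cf j (f + g) = cf j f + cf j g" for f g j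
    by (simp add: cf_def fps_eq_iff)
  have cf_x: "cf 0 (fps_const [:0, 1:] * g) = 0" "cf (Suc j) (fps_const [:0, 1:] * g) = cf j g"
    for g j
    by (simp_all add: cf_def fps_eq_iff)
  let ?G = "fubini_gf lam y"
  have minus1: "fps_const_coeffs (degen_exp lam 1) - 1 = fps_const_coeffs (degen_exp lam 1 - 1)"
    by (auto simp: fps_eq_iff fps_const_coeffs_def one_pCons)
  have "?G = fubini_denom lam * ?G
      + fps_const [:0, 1:] * (fps_const_coeffs (degen_exp lam 1 - 1) * ?G)"
    unfolding fubini_denom_def minus1 by (simp add: algebra_simps)
  then have rec: "?G = fps_const_coeffs (degen_exp lam y)
      + fps_const [:0, 1:] * (fps_const_coeffs (degen_exp lam 1 - 1) * ?G)"
    unfolding fubini_gf_eq .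
  have "cf j ?G = (degen_exp lam 1 - 1) ^ j * degen_exp lam y"
  proof (induction j)
    case 0
    show ?case by (subst rec) (simp add: cf_add cf_const cf_x)
  next
    case (Suc j)
    have "cf (Suc j) ?G = (degen_exp lam 1 - 1) * cf j ?G"
      by (subst rec) (simp add: cf_add cf_const cf_x cf_mult)
    then show ?case by (simp add: Suc.IH mult.assoc)
  qed
  then show ?thesis by (simp add: cf_def)
qed

text \<open>
  The factor \<open>k!\<close> makes this functional read coefficients with respect to \<open>t\<^sup>k / k!\<close>, as in the
  generating functions it is applied to.
\<close>

definition stirling_functional :: "real \<Rightarrow> nat \<Rightarrow> nat \<Rightarrow> real fps \<Rightarrow> real" where
  "stirling_functional lam r n f =
     (\<Sum>k\<le>n. (-1) ^ (n - k) * degen_rstirling1 lam r n k * (fact k * f $ k))"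

lemma stirling_functional_diff:
  "stirling_functional lam r n (f - g) =
     stirling_functional lam r n f - stirling_functional lam r n g"
  by (simp add: stirling_functional_def algebra_simps sum_subtractf)

lemma pochhammer_eq_sum_degen_rising:
  "pochhammer (z + real r) n = (\<Sum>k\<le>n. degen_rstirling1 lam r n k * degen_rising lam z k)"
proof -
  have "poly (pochhammer ([:0, 1:] + of_nat r) n) z =
      poly (\<Sum>k\<le>n. smult (degen_rstirling1 lam r n k) (degen_rising [:lam:] [:0, 1:] k)) z"
    using is_rstirling1_row_degen_rstirling1[of lam r n] by (simp add: is_rstirling1_row_def)
  then show ?thesis
    by (simp add: pochhammer_prod poly_prod poly_sum degen_rising_def
        atLeast0LessThan mult.commute[of lam])
qed

lemma degen_rising_uminus: "degen_rising lam (- y) k = (-1) ^ k * degen_falling lam y k"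
  unfolding degen_rising_def degen_falling_def
  by (induction k) (simp_all add: algebra_simps)

text \<open>
  Replacing \<open>y\<close> by \<open>-y\<close> turns rising into falling factorials on both sides of the defining identity
  of the Stirling numbers; this is where the alternating signs come from.
\<close>

lemma stirling_functional_degen_exp:
  "stirling_functional lam r n (degen_exp lam y) = fact n * ((y - real r) gchoose n)"
proof -
  have sign: "(-1) ^ (n - k) = (-1) ^ n * (-1 :: real) ^ k" if "k \<le> n" for k
    using that by (cases "even n"; cases "even k") auto
  have "stirling_functional lam r n (degen_exp lam y) =
      (-1) ^ n * (\<Sum>k\<le>n. degen_rstirling1 lam r n k * degen_rising lam (- y) k)"
    unfolding stirling_functional_def sum_distrib_left
    by (rule sum.cong) (simp_all add: sign degen_exp_def degen_rising_uminus)
  also have "\<dots> = (-1) ^ n * pochhammer (- (y - real r)) n"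
    by (simp flip: pochhammer_eq_sum_degen_rising)
  finally show ?thesis by (simp add: gbinomial_pochhammer)
qed

text \<open>
  Leaving \<open>y\<close> free is what makes the induction work: one more factor \<open>E - 1\<close> is a forward difference
  in \<open>y\<close>, evaluated by Pascal's rule. Once the binomial coefficient has become the constant 1, at
  \<open>j = n\<close>, further differences vanish.
\<close>

lemma stirling_functional_geometric_term:
  "stirling_functional lam r n ((degen_exp lam 1 - 1) ^ j * degen_exp lam y) =
     (if j \<le> n then fact n * ((y - real r) gchoose (n - j)) else 0)"
proof (induction j arbitrary: y)
  case 0
  show ?case by (simp add: stirling_functional_degen_exp)
next
  case (Suc j)
  have "(degen_exp lam 1 - 1) ^ Suc j * degen_exp lam y =
      (degen_exp lam 1 - 1) ^ j * degen_exp lam (y + 1)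
      - (degen_exp lam 1 - 1) ^ j * degen_exp lam y"
    by (simp add: degen_exp_add algebra_simps)
  then have step: "stirling_functional lam r n ((degen_exp lam 1 - 1) ^ Suc j * degen_exp lam y) =
      (if j \<le> n then fact n * ((y + 1 - real r) gchoose (n - j)) else 0)
      - (if j \<le> n then fact n * ((y - real r) gchoose (n - j)) else 0)"
    by (simp only: stirling_functional_diff Suc.IH)
  show ?case
  proof (cases "j < n")
    case True
    then obtain m where m: "n - j = Suc m" "n - Suc j = m"
      by (metis Suc_diff_Suc)
    have "(y + 1 - real r) gchoose Suc m =
        ((y - real r) gchoose m) + ((y - real r) gchoose Suc m)"
      using gbinomial_Suc_Suc[of "y - real r" m] by (simp add: algebra_simps)
    then show ?thesis
      using True m unfolding step by (simp add: add_diff_eq distrib_left)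
  next
    case False
    then show ?thesis unfolding step by auto
  qed
qed

lemma sum_rstirling1_fubini:
  "(\<Sum>k\<le>n. smult ((-1) ^ (n - k) * degen_rstirling1 lam r n k) (degen_fubini lam k (real r))) =
     monom (fact n) n"
proof (rule poly_eqI)
  fix j
  have "coeff (\<Sum>k\<le>n. smult ((-1) ^ (n - k) * degen_rstirling1 lam r n k)
        (degen_fubini lam k (real r))) j =
      stirling_functional lam r n (Abs_fps (\<lambda>k. coeff (fubini_gf lam (real r) $ k) j))"
    by (simp add: stirling_functional_def degen_fubini_def coeff_sum mult.assoc)
  also have "\<dots> = (if j \<le> n then fact n * (0 gchoose (n - j)) else 0)"
    by (simp add: coeff_fubini_gf stirling_functional_geometric_term)
  also have "\<dots> = coeff (monom (fact n) n) j"
    by (auto simp: gbinomial_0_left)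
  finally show "coeff (\<Sum>k\<le>n. smult ((-1) ^ (n - k) * degen_rstirling1 lam r n k)
      (degen_fubini lam k (real r))) j = coeff (monom (fact n) n) j" .
qed

theorem theorem4:
  fixes lam :: real and r n :: nat
  shows "[:0, 1:] ^ n * fact n =
           (\<Sum>k=0..n. smult ((-1) ^ (n - k) * degen_rstirling1 lam r n k)
             (degen_fubini lam k (real r))) \<and>
         (\<forall>x :: real. x ^ n * fact n =
           (\<Sum>k=0..n. (-1) ^ (n - k) * degen_rstirling1 lam r n k *
             poly (degen_fubini lam k (real r)) x))"
proof -
  have fact_poly: "(fact n :: real poly) = [:fact n:]"
    by (metis of_nat_fact of_nat_poly)
  have poly_eq: "[:0, 1:] ^ n * fact n =
      (\<Sum>k=0..n. smult ((-1) ^ (n - k) * degen_rstirling1 lam r n k)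
        (degen_fubini lam k (real r)))"
    by (simp add: atLeast0AtMost sum_rstirling1_fubini fact_poly monom_altdef)
  have "x ^ n * fact n =
      (\<Sum>k=0..n. (-1) ^ (n - k) * degen_rstirling1 lam r n k *
        poly (degen_fubini lam k (real r)) x)" for x :: real
    using arg_cong[OF poly_eq, of "\<lambda>p. poly p x"] 
    by (simp add: poly_sum fact_poly mult.commute)
  with poly_eq show ?thesis by blast
qed

end
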